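(* For any integer $k\geq 2$, $$\mathrm{Inv}(\mathbb{Z}_{2^k}[x])=\left\{a_0+2^{k-1}f \;\middle|\; a_0\in \mathrm{Inv}(\mathbb{Z}_{2^k}) \text{ and } f\in \mathbb{Z}_{2^k}[x]\right\}.$$ In addition, $\mathrm{Inv}(\mathbb{Z}_{2}[x])=\{1\}$.
   Context: $\mathbb{Z}_m$ denotes the ring of integers modulo $m$. For a commutative ring $R$ with identity, an element $u\in R$ is an involution if $u^2=1$, and $\mathrm{Inv}(R)$ denotes the set of involutions of $R$. Elements of $\mathbb{Z}_{2^k}$ are regarded as constant polynomials in $\mathbb{Z}_{2^k}[x]$. *)

theory Defs
  imports "HOL-Number_Theory.Residues" "HOL-Algebra.UnivPoly"
begin

definition Inv :: "('a, 'b) ring_scheme \<Rightarrow> 'a set" where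
  "Inv R = {u \<in> carrier R. u [^]\<^bsub>R\<^esub> (2::nat) = \<one>\<^bsub>R\<^esub>}"

(* residue_ring m represents the residue classes modulo m by 0..m - 1; monom, hence const_poly,
   is unspecified outside these representatives *)
abbreviation residue_poly_ring :: "int \<Rightarrow> (int, nat \<Rightarrow> int) up_ring" where
  "residue_poly_ring m \<equiv> UP (residue_ring m)"

definition const_poly :: "int \<Rightarrow> int \<Rightarrow> nat \<Rightarrow> int" where
  "const_poly m a = monom (residue_poly_ring m) a 0"

end

theory Submission
  imports Defs "HOL-Computational_Algebra.Polynomial"
begin

text \<open>
  Every polynomial over \<open>\<int>\<^sub>m\<close> lifts to an integer polynomial, and the lift of an involution is an
  \<open>F\<close> with \<open>m\<close> dividing \<open>F\<^sup>2 - 1 = (F - 1) (F + 1)\<close>.  The point of lifting is that \<open>\<int>[x]\<close> is an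
  integral domain in which \<open>2\<close> is a prime element, so that divisibility by powers of \<open>2\<close> can be
  studied by cancellation, whereas \<open>2\<close> is nilpotent modulo \<open>2\<^sup>k\<close>.  For \<open>m = 2\<^sup>k\<close> with \<open>k \<ge> 2\<close>, primality
  forces \<open>2\<close> to divide both \<open>F - 1\<close> and \<open>F + 1\<close>; after taking out one factor \<open>2\<close> from each, the
  cofactors differ by \<open>1\<close>, so only one of them is even and it absorbs the remaining \<open>2\<^sup>k\<^sup>-\<^sup>2\<close>.
  Hence \<open>F \<equiv> \<plusminus>1\<close> modulo \<open>2\<^sup>k\<^sup>-\<^sup>1\<close> (\<open>two_power_dvd_square_minus_one\<close>), and reducing modulo \<open>2\<^sup>k\<close>
  again gives the required form with \<open>a\<^sub>0 = \<plusminus>1\<close>.  Conversely, the square of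
  \<open>a\<^sub>0 + 2\<^sup>k\<^sup>-\<^sup>1 f\<close> is \<open>a\<^sub>0\<^sup>2 + 2\<^sup>k (a\<^sub>0 f + 2\<^sup>k\<^sup>-\<^sup>2 f\<^sup>2)\<close>.  For \<open>m = 2\<close> primality alone
  gives \<open>F \<equiv> 1\<close>.
\<close>

text \<open>
  If \<open>x = 1 + 2 h\<close>, then \<open>2\<^sup>k\<close> divides \<open>4 h (h + 1)\<close>, and the prime \<open>2\<close> cannot divide both
  \<open>h\<close> and \<open>h + 1\<close>.
\<close>

lemma two_power_dvd_square_minus_one:
  fixes x :: "'a :: {idom, algebraic_semidom}"
  assumes prime: "prime_elem (2 :: 'a)" and k: "k \<ge> 2" and dvd: "2 ^ k dvd x\<^sup>2 - 1"
  shows "2 ^ (k - 1) dvd x - 1 \<or> 2 ^ (k - 1) dvd x + 1"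
proof -
  have fact: "x\<^sup>2 - 1 = (x - 1) * (x + 1)"
    by (simp add: algebra_simps power2_eq_square)
  have "2 dvd x\<^sup>2 - 1"
    using dvd_trans[OF dvd_power[of k 2] dvd] k by simp
  then have "2 dvd x - 1 \<or> 2 dvd x + 1"
    using prime by (simp add: fact prime_elem_dvd_mult_iff)
  moreover have "x + 1 = (x - 1) + 2"
    by simp
  ultimately have "2 dvd x - 1"
    by (metis dvd_add_triv_right_iff)
  then obtain h where h: "x = 1 + 2 * h"
    by (metis add.commute diff_add_cancel dvdE)
  obtain j where j: "k = j + 2"
    using k by (metis add.commute le_Suc_ex)
  have "2\<^sup>2 * 2 ^ j dvd 2\<^sup>2 * (h * (h + 1))"
    using dvd by (simp add: h j algebra_simps power2_eq_square)
  then have dvd_h: "2 ^ j dvd h * (h + 1)"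
    using prime_elem_not_zeroI[OF prime] by (simp only: dvd_mult_cancel_left power_eq_0_iff) simp
  have "2 ^ j dvd h \<or> 2 ^ j dvd h + 1"
  proof (cases "j = 0")
    case False
    have "\<not> 2 dvd h \<or> \<not> 2 dvd h + 1"
      using prime by (metis dvd_add_right_iff prime_elem_not_unit)
    then show ?thesis
      using prime_power_dvd_multD[OF prime, of j h "h + 1"]
        prime_power_dvd_multD[OF prime, of j "h + 1" h] dvd_h False
      by (auto simp: mult.commute)
  qed simp
  then have "2 * 2 ^ j dvd 2 * h \<or> 2 * 2 ^ j dvd 2 * (h + 1)"
    by (meson dvd_refl mult_dvd_mono)
  then show ?thesis
    by (simp add: h j algebra_simps)
qed

definition reduce_poly :: "int \<Rightarrow> int poly \<Rightarrow> nat \<Rightarrow> int" where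
  "reduce_poly m F = (\<lambda>n. Polynomial.coeff F n mod m)"

lemma reduce_poly_eq_iff: "reduce_poly m F = reduce_poly m G \<longleftrightarrow> [:m:] dvd F - G"
  by (simp add: reduce_poly_def fun_eq_iff const_poly_dvd_iff mod_eq_dvd_iff)

context residues
begin

lemma reduce_poly_in_up: "reduce_poly m F \<in> up R"
proof
  show "reduce_poly m F n \<in> carrier R" for n
    by (simp add: reduce_poly_def)
  have "bound \<zero> (degree F) (reduce_poly m F)"
    by (auto simp: bound_def reduce_poly_def res_zero_eq coeff_eq_0)
  then show "\<exists>n. bound \<zero> n (reduce_poly m F)" ..
qed

lemma reduce_poly_carrier [simp]: "reduce_poly m F \<in> carrier (UP R)"
  using reduce_poly_in_up by (simp add: UP_def)

text \<open>
  Lifting coefficients to their representatives in \<open>{0..m - 1}\<close> gives a polynomial because the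
  zero of the residue ring is represented by the integer \<open>0\<close>.
\<close>

lemma ex_reduce_poly:
  assumes "p \<in> carrier (UP R)"
  shows "\<exists>F. p = reduce_poly m F"
proof -
  have p: "p \<in> up R"
    using assms by (simp add: UP_def)
  then obtain n where "bound \<zero> n p"
    by auto
  then have "Polynomial.coeff (Abs_poly p) = p"
    by (intro coeff_Abs_poly[of n]) (auto simp: bound_def res_zero_eq)
  moreover have "p i mod m = p i" for i
    using mem_upD[OF p, of i] by (simp add: res_carrier_eq)
  ultimately have "p = reduce_poly m (Abs_poly p)"
    by (simp add: reduce_poly_def)
  then show ?thesis ..
qed

lemma reduce_poly_add:
  "reduce_poly m F \<oplus>\<^bsub>UP R\<^esub> reduce_poly m G = reduce_poly m (F + G)"
  using reduce_poly_in_up[of F] reduce_poly_in_up[of G]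
  by (simp add: UP_def) (simp add: reduce_poly_def add_cong)

lemma reduce_poly_mult:
  "reduce_poly m F \<otimes>\<^bsub>UP R\<^esub> reduce_poly m G = reduce_poly m (F * G)"
  using reduce_poly_in_up[of F] reduce_poly_in_up[of G]
  by (simp add: UP_def) (simp add: reduce_poly_def mult_cong sum_cong Polynomial.coeff_mult)

lemma reduce_poly_one: "\<one>\<^bsub>UP R\<^esub> = reduce_poly m 1"
  using m_gt_one
  by (auto simp: UP_def reduce_poly_def res_one_eq res_zero_eq fun_eq_iff)

lemma const_poly_mod: "const_poly m (a mod m) = reduce_poly m [:a:]"
  using mod_in_carrier[of a]
  by (auto simp: const_poly_def UP_def reduce_poly_def R_m_def residue_ring_def fun_eq_iff
      coeff_pCons split: nat.splits)

lemma mem_Inv_residue_ring_iff: "a \<in> Inv R \<longleftrightarrow> a \<in> {0..m - 1} \<and> m dvd a\<^sup>2 - 1"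
proof -
  have "a [^] (2::nat) = a\<^sup>2 mod m" if "a \<in> {0..m - 1}"
    using pow_cong[of a 2] that by simp
  then show ?thesis
    by (auto simp: Inv_def res_carrier_eq one_cong simp flip: mod_eq_dvd_iff)
qed

lemma reduce_poly_mem_Inv_iff: "reduce_poly m F \<in> Inv (UP R) \<longleftrightarrow> [:m:] dvd F\<^sup>2 - 1"
proof -
  interpret UP_cring R "UP R"
    by unfold_locales simp
  have "reduce_poly m F [^]\<^bsub>UP R\<^esub> (2::nat) = reduce_poly m (F\<^sup>2)"
    by (simp add: numeral_2_eq_2 reduce_poly_mult P.nat_pow_Suc)
  then show ?thesis
    by (simp add: Inv_def reduce_poly_one reduce_poly_eq_iff)
qed

end

lemma prime_elem_two_int_poly: "prime_elem (2 :: int poly)"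
  using lift_prime_elem_poly[of "2 :: int"] by (simp add: numeral_poly)

lemma const_poly_power: "[:a ^ n:] = [:a:] ^ n"
  proof (induction n)
  case (Suc n)
  have "[:a ^ Suc n:] = [:a:] * [:a ^ n:]"
    by (simp add: mult.commute)
  then show ?case
    by (simp only: Suc.IH power_Suc)
qed (simp add: one_pCons)

lemma Inv_residue_poly_ring_two_power:
  fixes k :: nat
  assumes k: "k \<ge> 2"
  defines "P \<equiv> residue_poly_ring (2 ^ k)"
  shows "Inv P =
    {const_poly (2 ^ k) a \<oplus>\<^bsub>P\<^esub> (const_poly (2 ^ k) (2 ^ (k - 1)) \<otimes>\<^bsub>P\<^esub> f) | a f.
      a \<in> Inv (residue_ring (2 ^ k)) \<and> f \<in> carrier P}" (is "_ = ?rhs")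
proof -
  let ?m = "2 ^ k :: int" and ?c = "2 ^ (k - 1) :: int"
  have m_gt_1: "?m > 1"
    using k by (intro one_less_power) auto
  interpret residues ?m "residue_ring ?m"
    by unfold_locales (use m_gt_1 in auto)
  have m_eq: "?m = 2 * ?c"
    using k by (simp flip: power_Suc)
  have c_sq: "?m dvd ?c * ?c"
    using k by (simp flip: power_add add: le_imp_power_dvd)
  have c_mod: "?c mod ?m = ?c"
    using m_eq by simp
  have form: "const_poly ?m (a mod ?m) \<oplus>\<^bsub>P\<^esub> (const_poly ?m ?c \<otimes>\<^bsub>P\<^esub> reduce_poly ?m G)
      = reduce_poly ?m ([:a:] + [:?c:] * G)" for a G
    using const_poly_mod[of a] const_poly_mod[of ?c]
    unfolding P_def c_mod by (simp only: reduce_poly_mult reduce_poly_add)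
  show ?thesis
  proof (intro equalityI subsetI)
    fix u
    assume u: "u \<in> Inv P"
    then obtain F where F: "u = reduce_poly ?m F"
      using ex_reduce_poly[of u] by (auto simp: Inv_def P_def)
    have dvd: "[:?m:] dvd F\<^sup>2 - 1"
      using u by (simp add: F P_def reduce_poly_mem_Inv_iff)
    have "2 ^ (k - 1) dvd F - 1 \<or> 2 ^ (k - 1) dvd F + 1"
      using two_power_dvd_square_minus_one[OF prime_elem_two_int_poly k, of F] dvd
      by (simp add: const_poly_power numeral_poly)
    then have "\<exists>a. a\<^sup>2 = 1 \<and> [:?c:] dvd F - [:a:]"
    proof
      assume "2 ^ (k - 1) dvd F - 1"
      then show ?thesis
        by (intro exI[of _ 1]) (simp add: const_poly_power numeral_poly one_pCons)
    next
      assume "2 ^ (k - 1) dvd F + 1"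
      then show ?thesis
        by (intro exI[of _ "-1"]) (simp add: const_poly_power numeral_poly one_pCons diff_conv_add_uminus del: add_uminus_conv_diff)
    qed
    then obtain a G where a: "a\<^sup>2 = 1" and G: "F = [:a:] + [:?c:] * G"
      by (metis add.commute diff_add_cancel dvdE)
    have "a mod ?m \<in> Inv (residue_ring ?m)"
      using a by (simp add: mem_Inv_residue_ring_iff flip: mod_eq_dvd_iff)
        (simp add: power_mod)
    moreover have "u = const_poly ?m (a mod ?m) \<oplus>\<^bsub>P\<^esub> (const_poly ?m ?c \<otimes>\<^bsub>P\<^esub> reduce_poly ?m G)"
      by (simp only: F G form)
    moreover have "reduce_poly ?m G \<in> carrier P"
      by (simp add: P_def)
    ultimately show "u \<in> ?rhs"
      by blast
  next
    fix u
    assume "u \<in> ?rhs"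
    then obtain a f where a: "a \<in> Inv (residue_ring ?m)" and f: "f \<in> carrier P"
      and u: "u = const_poly ?m a \<oplus>\<^bsub>P\<^esub> (const_poly ?m ?c \<otimes>\<^bsub>P\<^esub> f)"
      by blast
    obtain G where G: "f = reduce_poly ?m G"
      using ex_reduce_poly f by (auto simp: P_def)
    have a_mod: "a mod ?m = a" and a_sq: "?m dvd a\<^sup>2 - 1"
      using a by (auto simp: mem_Inv_residue_ring_iff)
    have "u = reduce_poly ?m ([:a:] + [:?c:] * G)"
      using form[of a G] by (simp add: u G a_mod)
    moreover have "([:a:] + [:?c:] * G)\<^sup>2 - 1
        = [:a\<^sup>2 - 1:] + [:?m:] * ([:a:] * G) + [:?c * ?c:] * G\<^sup>2"
    proof -
      have "[:a\<^sup>2 - 1:] = [:a:] * [:a:] - 1" "[:?m:] = 2 * [:?c:]" "[:?c * ?c:] = [:?c:] * [:?c:]"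
        unfolding m_eq by (simp_all add: power2_eq_square one_pCons numeral_poly)
      then show ?thesis
        by (simp only: power2_eq_square) (simp only: algebra_simps mult_2 mult_2_right)
    qed
    moreover have "[:?m:] dvd \<dots>"
      using a_sq c_sq by (intro dvd_add dvd_mult2) auto
    ultimately show "u \<in> Inv P"
      by (simp add: P_def reduce_poly_mem_Inv_iff)
  qed
qed

lemma Inv_residue_poly_ring_two: "Inv (residue_poly_ring 2) = {\<one>\<^bsub>residue_poly_ring 2\<^esub>}"
proof -
  interpret residues 2 "residue_ring 2"
    by unfold_locales auto
  have "u = \<one>\<^bsub>residue_poly_ring 2\<^esub>" if u: "u \<in> Inv (residue_poly_ring 2)" for u
  proof -
    obtain F where F: "u = reduce_poly 2 F"
      using ex_reduce_poly[of u] u by (auto simp: Inv_def)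
    have "2 dvd F\<^sup>2 - 1"
      using u by (simp add: F reduce_poly_mem_Inv_iff numeral_poly)
    \<comment> \<open>The two factors of \<open>F\<^sup>2 - 1\<close> agree modulo \<open>2\<close>, so it is a square there.\<close>
    moreover have "F\<^sup>2 - 1 = (F - 1)\<^sup>2 + 2 * (F - 1)"
      by (simp add: power2_eq_square algebra_simps)
    ultimately have "2 dvd (F - 1)\<^sup>2"
      by (metis dvd_add_left_iff dvd_triv_left)
    then have "2 dvd F - 1"
      using prime_elem_two_int_poly prime_elem_dvd_power by blast
    then show ?thesis
      by (simp add: F reduce_poly_one reduce_poly_eq_iff numeral_poly)
  qed
  moreover have "\<one>\<^bsub>residue_poly_ring 2\<^esub> \<in> Inv (residue_poly_ring 2)"
    by (simp add: reduce_poly_one reduce_poly_mem_Inv_iff)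
  ultimately show ?thesis
    by blast
qed

theorem proposition2p4:
  shows "(\<forall>k::nat. k \<ge> 2 \<longrightarrow>
           Inv (residue_poly_ring (2 ^ k)) =
             {const_poly (2 ^ k) a\<^sub>0 \<oplus>\<^bsub>residue_poly_ring (2 ^ k)\<^esub>
                (const_poly (2 ^ k) (2 ^ (k - 1)) \<otimes>\<^bsub>residue_poly_ring (2 ^ k)\<^esub> f) | a\<^sub>0 f.
                a\<^sub>0 \<in> Inv (residue_ring (2 ^ k)) \<and> f \<in> carrier (residue_poly_ring (2 ^ k))})
         \<and> Inv (residue_poly_ring 2) = {\<one>\<^bsub>residue_poly_ring 2\<^esub>}"
  using Inv_residue_poly_ring_two_power Inv_residue_poly_ring_two by blast

end
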